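(* Let $m,n$ be non-negative integers with $(m,n)\neq(0,0)$ and let $R$ be an NI ring which is $(m,n)$-regularly nil clean. Then $R$ is regularly nil clean.
   Context: All rings are associative with identity (not necessarily commutative). A ring $R$ is called NI if its set of nilpotent elements is a (two-sided) ideal of $R$. A ring $R$ is called regularly nil clean if for every $a\in R$ there exists an idempotent $e\in Ra$ such that $a(1-e)$ is nilpotent. For non-negative integers $m,n$, a ring $R$ is called $(m,n)$-regularly nil clean if for every $a\in R$ there exists an idempotent $e\in a^mRa^n$ such that $a^m(1-e)a^n$ is nilpotent (with the convention $a^0=1$). *)

theory Defs
  imports "HOL-Algebra.Ideal"
begin

text \<open>Allowing \<open>k = 0\<close> makes no difference: \<open>a\<close> to the power \<open>0\<close> is \<open>\<one>\<close>, which is \<open>\<zero>\<close> only in the zero ring.\<close>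

definition nilpotent_elem :: "('a, 'b) ring_scheme \<Rightarrow> 'a \<Rightarrow> bool" where
  "nilpotent_elem R a \<longleftrightarrow> a \<in> carrier R \<and> (\<exists>k::nat. a [^]\<^bsub>R\<^esub> k = \<zero>\<^bsub>R\<^esub>)"

definition idempotent_elem :: "('a, 'b) ring_scheme \<Rightarrow> 'a \<Rightarrow> bool" where
  "idempotent_elem R e \<longleftrightarrow> e \<in> carrier R \<and> e \<otimes>\<^bsub>R\<^esub> e = e"

text \<open>In \<open>HOL-Algebra\<close>, \<open>ring R\<close> is an associative, not necessarily commutative ring with identity
  (the zero ring included), and \<open>ideal\<close> means two-sided ideal.\<close>

definition NI_ring :: "('a, 'b) ring_scheme \<Rightarrow> bool" where
  "NI_ring R \<longleftrightarrow> ring R \<and> ideal {a. nilpotent_elem R a} R"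

definition regularly_nil_clean :: "('a, 'b) ring_scheme \<Rightarrow> bool" where
  "regularly_nil_clean R \<longleftrightarrow> ring R \<and>
     (\<forall>a \<in> carrier R. \<exists>e \<in> {r \<otimes>\<^bsub>R\<^esub> a | r. r \<in> carrier R}.
        idempotent_elem R e \<and> nilpotent_elem R (a \<otimes>\<^bsub>R\<^esub> (\<one>\<^bsub>R\<^esub> \<ominus>\<^bsub>R\<^esub> e)))"

definition mn_regularly_nil_clean :: "nat \<Rightarrow> nat \<Rightarrow> ('a, 'b) ring_scheme \<Rightarrow> bool" where
  "mn_regularly_nil_clean m n R \<longleftrightarrow> ring R \<and>
     (\<forall>a \<in> carrier R.
        \<exists>e \<in> {a [^]\<^bsub>R\<^esub> m \<otimes>\<^bsub>R\<^esub> r \<otimes>\<^bsub>R\<^esub> a [^]\<^bsub>R\<^esub> n | r. r \<in> carrier R}.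
          idempotent_elem R e \<and>
          nilpotent_elem R (a [^]\<^bsub>R\<^esub> m \<otimes>\<^bsub>R\<^esub> (\<one>\<^bsub>R\<^esub> \<ominus>\<^bsub>R\<^esub> e) \<otimes>\<^bsub>R\<^esub> a [^]\<^bsub>R\<^esub> n))"

end

theory Submission
  imports Defs
begin

text \<open>
  In an NI ring the nil ideal \<open>N\<close> is completely semiprime, hence \<open>x y \<in> N\<close> implies
  \<open>y x \<in> N\<close> and \<open>x z y \<in> N\<close> for all \<open>z\<close>. If \<open>e = a\<^sup>m r a\<^sup>n\<close> is the given idempotent, then
  \<open>a\<^sup>m (1 - e) a\<^sup>n \<in> N\<close> therefore yields \<open>(1 - e) a\<^sup>m\<^sup>+\<^sup>n \<in> N\<close>, and then \<open>(1 - e) a \<in> N\<close> and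
  \<open>a (1 - e) \<in> N\<close>. If \<open>n > 0\<close>, then \<open>e\<close> lies in \<open>R a\<close> already. If \<open>n = 0\<close>, then \<open>e = a s\<close> for some
  \<open>s\<close>, and \<open>f = s e a\<close> is an idempotent of \<open>R a\<close> with \<open>a (1 - f) = (1 - e) a\<close>.
\<close>

context ring
begin

lemma nat_pow_mult_swap:
  assumes "x \<in> carrier R" "y \<in> carrier R"
  shows "(y \<otimes> x) [^] Suc k = y \<otimes> (x \<otimes> y) [^] k \<otimes> x"
  using assms by (induction k) (simp_all add: m_assoc)

text \<open>Reassociating, \<open>(y x)^(k+1) = y (x y)^k x\<close>, so once \<open>(x y)^k\<close>
  vanishes, so does the next power of \<open>y x\<close>.\<close>

lemma nilpotent_elem_swap:
  assumes "x \<in> carrier R" "y \<in> carrier R" "nilpotent_elem R (x \<otimes> y)"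
  shows "nilpotent_elem R (y \<otimes> x)"
proof -
  obtain k :: nat where "(x \<otimes> y) [^] k = \<zero>"
    using assms(3) unfolding nilpotent_elem_def by blast
  then have "(y \<otimes> x) [^] Suc k = \<zero>"
    using assms(1,2) nat_pow_mult_swap[of x y k] by simp
  then show ?thesis
    using assms(1,2) unfolding nilpotent_elem_def by blast
qed

lemma nilpotent_elem_square:
  assumes "x \<in> carrier R" "nilpotent_elem R (x \<otimes> x)"
  shows "nilpotent_elem R x"
proof -
  obtain k :: nat where "(x \<otimes> x) [^] k = \<zero>"
    using assms(2) unfolding nilpotent_elem_def by blast
  moreover have "x \<otimes> x = x [^] (2::nat)"
    using assms(1) by (simp add: numeral_2_eq_2)
  ultimately have "x [^] (2 * k) = \<zero>"
    using assms(1) by (simp add: nat_pow_pow)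
  then show ?thesis
    using assms(1) unfolding nilpotent_elem_def by blast
qed

context
  assumes NI: "ideal {x. nilpotent_elem R x} R"
begin

lemma nilpotent_elem_mult_left:
  "nilpotent_elem R x \<Longrightarrow> z \<in> carrier R \<Longrightarrow> nilpotent_elem R (z \<otimes> x)"
  using ideal.I_l_closed[OF NI] by simp

lemma nilpotent_elem_mult_right:
  "nilpotent_elem R x \<Longrightarrow> z \<in> carrier R \<Longrightarrow> nilpotent_elem R (x \<otimes> z)"
  using ideal.I_r_closed[OF NI] by simp

text \<open>The square of \<open>x z y\<close> contains the factor \<open>y x\<close>, which is
  nilpotent by swapping. The ideal absorbs the remaining factors, and an element with nilpotent
  square is nilpotent.\<close>

lemma nilpotent_elem_insert:
  assumes [simp]: "x \<in> carrier R" "y \<in> carrier R" "z \<in> carrier R"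
    and xy: "nilpotent_elem R (x \<otimes> y)"
  shows "nilpotent_elem R (x \<otimes> z \<otimes> y)"
proof (rule nilpotent_elem_square)
  have "nilpotent_elem R ((x \<otimes> z) \<otimes> (y \<otimes> x) \<otimes> (z \<otimes> y))"
    using nilpotent_elem_mult_right[OF nilpotent_elem_mult_left[OF nilpotent_elem_swap[OF _ _ xy]]]
    by simp
  then show "nilpotent_elem R (x \<otimes> z \<otimes> y \<otimes> (x \<otimes> z \<otimes> y))"
    by (simp add: m_assoc)
qed simp

lemma nilpotent_elem_mult_pow:
  assumes [simp]: "x \<in> carrier R" "a \<in> carrier R"
    and "nilpotent_elem R (x \<otimes> a [^] Suc k)"
  shows "nilpotent_elem R (x \<otimes> a)"
  using assms(3)
proof (induction k)
  case 0
  then show ?case by simp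
next
  case (Suc k)
  let ?b = "x \<otimes> a [^] Suc k"
  have "nilpotent_elem R (?b \<otimes> a)"
    using Suc.prems by (simp add: m_assoc)
  \<comment> \<open>Inserting \<open>x a^k\<close> between \<open>?b\<close> and \<open>a\<close>
    produces exactly \<open>?b ?b\<close>, so one factor \<open>a\<close> is removed by passing to a
    square.\<close>
  then have "nilpotent_elem R (?b \<otimes> (x \<otimes> a [^] k) \<otimes> a)"
    by (rule nilpotent_elem_insert[rotated -1]) simp_all
  then have "nilpotent_elem R (?b \<otimes> ?b)"
    by (simp add: m_assoc)
  then have "nilpotent_elem R ?b"
    by (rule nilpotent_elem_square[rotated]) simp_all
  then show ?case by (rule Suc.IH)
qed

text \<open>Swapping moves \<open>a^m\<close> to the far right, where it merges with
  \<open>a^n\<close> into a power of positive exponent, which can then be lowered to 1. It is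
  applied with \<open>x = 1 - e\<close>.\<close>

lemma nilpotent_elem_pow_mult_pow:
  assumes [simp]: "x \<in> carrier R" "a \<in> carrier R"
    and "(m, n) \<noteq> (0::nat, 0::nat)"
    and nil: "nilpotent_elem R (a [^] m \<otimes> x \<otimes> a [^] n)"
  shows "nilpotent_elem R (x \<otimes> a)"
proof -
  obtain k where k: "n + m = Suc k"
    using assms(3) by (cases "n + m") auto
  have "nilpotent_elem R (x \<otimes> a [^] n \<otimes> a [^] m)"
    using nil by (intro nilpotent_elem_swap[of "a [^] m"]) (simp_all add: m_assoc)
  then have "nilpotent_elem R (x \<otimes> a [^] Suc k)"
    by (simp add: m_assoc nat_pow_mult k del: nat_pow_Suc)
  then show ?thesis
    by (rule nilpotent_elem_mult_pow[rotated -1]) simp_all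
qed

end

text \<open>With \<open>e = a s\<close> and \<open>f = s e a\<close>, one has
  \<open>a f = (a s) e a = e e a = e a\<close>. Both claims follow:
  \<open>f f = s e (a f) = s e e a = f\<close>, and \<open>a - a f = a - e a\<close>.\<close>

lemma idempotent_elem_conj:
  assumes [simp]: "a \<in> carrier R" "s \<in> carrier R"
    and idem: "idempotent_elem R (a \<otimes> s)"
  shows "idempotent_elem R (s \<otimes> (a \<otimes> s) \<otimes> a)"
    and "a \<otimes> (\<one> \<ominus> s \<otimes> (a \<otimes> s) \<otimes> a) = (\<one> \<ominus> a \<otimes> s) \<otimes> a"
proof -
  define e where "e = a \<otimes> s"
  have e [simp]: "e \<in> carrier R" and ee: "e \<otimes> e = e"
    using idem unfolding e_def idempotent_elem_def by auto
  have af: "a \<otimes> (s \<otimes> e \<otimes> a) = e \<otimes> a"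
  proof -
    have "a \<otimes> (s \<otimes> e \<otimes> a) = (a \<otimes> s) \<otimes> e \<otimes> a" by (simp add: m_assoc)
    then show ?thesis by (simp add: ee flip: e_def)
  qed
  have "(s \<otimes> e \<otimes> a) \<otimes> (s \<otimes> e \<otimes> a) = s \<otimes> (e \<otimes> e) \<otimes> a"
    using af by (simp add: m_assoc)
  then show "idempotent_elem R (s \<otimes> (a \<otimes> s) \<otimes> a)"
    by (simp add: idempotent_elem_def ee flip: e_def)
  show "a \<otimes> (\<one> \<ominus> s \<otimes> (a \<otimes> s) \<otimes> a) = (\<one> \<ominus> a \<otimes> s) \<otimes> a"
    using af by (simp add: minus_eq r_distr l_distr r_minus l_minus flip: e_def)
qed

end

theorem corollary2p12:
  fixes R :: "('a, 'b) ring_scheme" and m n :: nat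
  assumes "(m, n) \<noteq> (0, 0)"
    and "NI_ring R"
    and "mn_regularly_nil_clean m n R"
  shows "regularly_nil_clean R"
proof -
  interpret ring R using assms(2) unfolding NI_ring_def by simp
  have NI: "ideal {x. nilpotent_elem R x} R"
    using assms(2) unfolding NI_ring_def by simp
  have "\<exists>f \<in> {r \<otimes>\<^bsub>R\<^esub> a | r. r \<in> carrier R}.
      idempotent_elem R f \<and> nilpotent_elem R (a \<otimes>\<^bsub>R\<^esub> (\<one>\<^bsub>R\<^esub> \<ominus>\<^bsub>R\<^esub> f))"
    if a [simp]: "a \<in> carrier R" for a
  proof -
    obtain r e where r [simp]: "r \<in> carrier R"
      and e: "e = a [^]\<^bsub>R\<^esub> m \<otimes>\<^bsub>R\<^esub> r \<otimes>\<^bsub>R\<^esub> a [^]\<^bsub>R\<^esub> n"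
      and idem: "idempotent_elem R e"
      and nil: "nilpotent_elem R (a [^]\<^bsub>R\<^esub> m \<otimes>\<^bsub>R\<^esub> (\<one>\<^bsub>R\<^esub> \<ominus>\<^bsub>R\<^esub> e) \<otimes>\<^bsub>R\<^esub> a [^]\<^bsub>R\<^esub> n)"
      using assms(3) a unfolding mn_regularly_nil_clean_def by blast
    have [simp]: "e \<in> carrier R" unfolding e by simp
    have nil': "nilpotent_elem R ((\<one>\<^bsub>R\<^esub> \<ominus>\<^bsub>R\<^esub> e) \<otimes>\<^bsub>R\<^esub> a)"
      by (rule nilpotent_elem_pow_mult_pow[OF NI _ a assms(1) nil]) simp
    have multiple: "x \<otimes>\<^bsub>R\<^esub> a \<in> {r \<otimes>\<^bsub>R\<^esub> a | r. r \<in> carrier R}" if "x \<in> carrier R" for x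
      using that by blast
    show ?thesis
    proof (cases n)
      \<comment> \<open>Here \<open>e\<close> itself is the witness: a factor \<open>a\<close>
        splits off on the right of \<open>a^n\<close>.\<close>
      case (Suc n')
      have "e = (a [^]\<^bsub>R\<^esub> m \<otimes>\<^bsub>R\<^esub> r \<otimes>\<^bsub>R\<^esub> a [^]\<^bsub>R\<^esub> n') \<otimes>\<^bsub>R\<^esub> a"
        by (simp add: e Suc m_assoc)
      then have "e \<in> {r \<otimes>\<^bsub>R\<^esub> a | r. r \<in> carrier R}"
        using multiple[of "a [^]\<^bsub>R\<^esub> m \<otimes>\<^bsub>R\<^esub> r \<otimes>\<^bsub>R\<^esub> a [^]\<^bsub>R\<^esub> n'"] by simp
      moreover have "nilpotent_elem R (a \<otimes>\<^bsub>R\<^esub> (\<one>\<^bsub>R\<^esub> \<ominus>\<^bsub>R\<^esub> e))"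
        by (rule nilpotent_elem_swap[OF _ _ nil']) simp_all
      ultimately show ?thesis using idem by blast
    next
      case 0
      then obtain m' where m': "m = Suc m'"
        using assms(1) by (cases m) auto
      define s where "s = a [^]\<^bsub>R\<^esub> m' \<otimes>\<^bsub>R\<^esub> r"
      have s [simp]: "s \<in> carrier R" unfolding s_def by simp
      \<comment> \<open>Since \<open>a^n = 1\<close>, only the left power remains;
        \<open>nat_pow_Suc2\<close> takes its factor \<open>a\<close> out on the left, whereas
        \<open>nat_pow_Suc\<close> would put it on the right.\<close>
      have as: "e = a \<otimes>\<^bsub>R\<^esub> s"
        using nat_pow_Suc2[OF a, of m'] by (simp add: e 0 m' s_def m_assoc del: nat_pow_Suc)
      let ?f = "s \<otimes>\<^bsub>R\<^esub> (a \<otimes>\<^bsub>R\<^esub> s) \<otimes>\<^bsub>R\<^esub> a"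
      \<comment> \<open>As \<open>a (1 - f) = (1 - e) a\<close>, the nilpotency is literally that of
        \<open>nil'\<close>.\<close>
      have "idempotent_elem R ?f" "nilpotent_elem R (a \<otimes>\<^bsub>R\<^esub> (\<one>\<^bsub>R\<^esub> \<ominus>\<^bsub>R\<^esub> ?f))"
        using idempotent_elem_conj[OF a s] idem nil' unfolding as by simp_all
      moreover have "?f \<in> {r \<otimes>\<^bsub>R\<^esub> a | r. r \<in> carrier R}"
        by (rule multiple) simp
      ultimately show ?thesis by blast
    qed
  qed
  then show ?thesis
    unfolding regularly_nil_clean_def using ring_axioms by blast
qed

end
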